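(* Let $\mathcal{A}$ be an abelian category with a generator $G$, small direct sums and exact small products. An inverse sequence $S$ in $\mathcal{A}$ is local if and only if it is a $(1-I)$-local object of the category $\mathcal{A}^{\omega^{\mathrm{op}}}$ of inverse sequences in $\mathcal{A}$, where $1-I:\tilde G\to\tilde G$ is the morphism of inverse sequences defined in the context.
   Context: A generator of $\mathcal{A}$ is an object $G$ such that the functor $\mathcal{A}(G,-)$ is faithful. An inverse sequence $S$ in $\mathcal{A}$ consists of objects $S_i$ and morphisms $f_i:S_{i+1}\to S_i$, $i\in\omega=\{0,1,2,\dots\}$, i.e. it is a functor $\omega^{\mathrm{op}}\to\mathcal{A}$. The objects $\lim S$ and $\lim^1 S$ (the limit and its first right derived functor) are the kernel and the cokernel of $1-F:\prod_i S_i\to\prod_i S_i$, where $\mathrm{pr}_jF=f_j\,\mathrm{pr}_{j+1}$. $S$ is called local if $\lim S=\lim^1 S=0$. For a morphism $\theta:c'\to c$ of a category $\mathcal{C}$, an object $l$ is $\theta$-local if $\theta^*:\mathcal{C}(c,l)\to\mathcal{C}(c',l)$ is a bijection. For $n\in\omega$, $G(n)$ denotes the inverse sequence with $G(n)_i=G$ for $i\le n$, $G(n)_i=0$ for $i>n$, and $f_i=1_G$ for $i<n$. The morphism $\iota(n):G(n)\to G(n+1)$ is given by $\iota(n)_i=1_G$ for $i\le n$ and $\iota(n)_i=0$ for $i>n$. Put $\tilde G=\bigoplus_{i<\omega}G(i)$, with canonical embeddings $\mathrm{em}_n:G(n)\to\tilde G$. The morphism $I:\tilde G\to\tilde G$ is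 defined by $I\,\mathrm{em}_n=\mathrm{em}_{n+1}\,\iota(n)$ for all $n$, and $1-I$ is the difference of the identity and $I$. *)

theory Defs
  imports "HOL-Algebra.Group" "HOL-Library.Equipollence"
begin

section \<open>Categories with an additive structure on morphisms\<close>

record ('o, 'm) category =
  Obj :: "'o set"
  Arr :: "'m set"
  Dom :: "'m \<Rightarrow> 'o"
  Cod :: "'m \<Rightarrow> 'o"
  Idt :: "'o \<Rightarrow> 'm"
  Comp :: "'m \<Rightarrow> 'm \<Rightarrow> 'm" (infixl "\<cdot>\<index>" 70)

record ('o, 'm) preadd_category = "('o, 'm) category" +
  Add :: "'m \<Rightarrow> 'm \<Rightarrow> 'm"
  Zero :: "'o \<Rightarrow> 'o \<Rightarrow> 'm"

definition Mor :: "('o, 'm, 'z) category_scheme \<Rightarrow> 'o \<Rightarrow> 'o \<Rightarrow> 'm set" where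
  "Mor C a b = {f \<in> Arr C. Dom C f = a \<and> Cod C f = b}"

locale category =
  fixes C :: "('o, 'm, 'z) category_scheme" (structure)
  assumes dom_obj: "f \<in> Arr C \<Longrightarrow> Dom C f \<in> Obj C"
    and cod_obj: "f \<in> Arr C \<Longrightarrow> Cod C f \<in> Obj C"
    and idt_mor: "a \<in> Obj C \<Longrightarrow> Idt C a \<in> Mor C a a"
    and comp_mor: "\<lbrakk>f \<in> Mor C a b; g \<in> Mor C b c\<rbrakk> \<Longrightarrow> g \<cdot> f \<in> Mor C a c"
    and comp_idt: "f \<in> Mor C a b \<Longrightarrow> f \<cdot> Idt C a = f"
    and idt_comp: "f \<in> Mor C a b \<Longrightarrow> Idt C b \<cdot> f = f"
    and comp_assoc: "\<lbrakk>f \<in> Mor C a b; g \<in> Mor C b c; h \<in> Mor C c d\<rbrakk>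
      \<Longrightarrow> h \<cdot> (g \<cdot> f) = (h \<cdot> g) \<cdot> f"

text \<open>The abelian group of morphisms from \<open>a\<close> to \<open>b\<close>, in the multiplicative record of HOL-Algebra.\<close>

definition mor_group :: "('o, 'm, 'z) preadd_category_scheme \<Rightarrow> 'o \<Rightarrow> 'o \<Rightarrow> 'm monoid" where
  "mor_group C a b = \<lparr>carrier = Mor C a b, monoid.mult = Add C, one = Zero C a b\<rparr>"

definition mor_diff :: "('o, 'm, 'z) preadd_category_scheme \<Rightarrow> 'm \<Rightarrow> 'm \<Rightarrow> 'm" where
  "mor_diff C f g = Add C f (inv\<^bsub>mor_group C (Dom C g) (Cod C g)\<^esub> g)"

locale preadditive_category = category C
  for C :: "('o, 'm, 'z) preadd_category_scheme" (structure) +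
  assumes mor_comm_group: "\<lbrakk>a \<in> Obj C; b \<in> Obj C\<rbrakk> \<Longrightarrow> comm_group (mor_group C a b)"
    and comp_add: "\<lbrakk>f \<in> Mor C a b; g \<in> Mor C a b; h \<in> Mor C b c\<rbrakk>
      \<Longrightarrow> h \<cdot> Add C f g = Add C (h \<cdot> f) (h \<cdot> g)"
    and add_comp: "\<lbrakk>f \<in> Mor C b c; g \<in> Mor C b c; h \<in> Mor C a b\<rbrakk>
      \<Longrightarrow> Add C f g \<cdot> h = Add C (f \<cdot> h) (g \<cdot> h)"

section \<open>Universal constructions\<close>

definition is_zero_object :: "('o, 'm, 'z) category_scheme \<Rightarrow> 'o \<Rightarrow> bool" where
  "is_zero_object C z \<longleftrightarrow> z \<in> Obj C \<and>
    (\<forall>a \<in> Obj C. (\<exists>!f. f \<in> Mor C z a) \<and> (\<exists>!f. f \<in> Mor C a z))"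

definition is_product ::
  "('o, 'm, 'z) category_scheme \<Rightarrow> 'i set \<Rightarrow> ('i \<Rightarrow> 'o) \<Rightarrow> 'o \<Rightarrow> ('i \<Rightarrow> 'm) \<Rightarrow> bool" where
  "is_product C I X P pr \<longleftrightarrow> P \<in> Obj C \<and> (\<forall>i\<in>I. pr i \<in> Mor C P (X i)) \<and>
    (\<forall>Y\<in>Obj C. \<forall>g. (\<forall>i\<in>I. g i \<in> Mor C Y (X i)) \<longrightarrow>
      (\<exists>!h. h \<in> Mor C Y P \<and> (\<forall>i\<in>I. pr i \<cdot>\<^bsub>C\<^esub> h = g i)))"

definition is_coproduct ::
  "('o, 'm, 'z) category_scheme \<Rightarrow> 'i set \<Rightarrow> ('i \<Rightarrow> 'o) \<Rightarrow> 'o \<Rightarrow> ('i \<Rightarrow> 'm) \<Rightarrow> bool" where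
  "is_coproduct C I X Q em \<longleftrightarrow> Q \<in> Obj C \<and> (\<forall>i\<in>I. em i \<in> Mor C (X i) Q) \<and>
    (\<forall>Y\<in>Obj C. \<forall>g. (\<forall>i\<in>I. g i \<in> Mor C (X i) Y) \<longrightarrow>
      (\<exists>!h. h \<in> Mor C Q Y \<and> (\<forall>i\<in>I. h \<cdot>\<^bsub>C\<^esub> em i = g i)))"

definition is_kernel :: "('o, 'm, 'z) preadd_category_scheme \<Rightarrow> 'm \<Rightarrow> 'm \<Rightarrow> bool" where
  "is_kernel C f k \<longleftrightarrow> f \<in> Arr C \<and> k \<in> Arr C \<and> Cod C k = Dom C f \<and>
    f \<cdot>\<^bsub>C\<^esub> k = Zero C (Dom C k) (Cod C f) \<and>
    (\<forall>Y\<in>Obj C. \<forall>g\<in>Mor C Y (Dom C f). f \<cdot>\<^bsub>C\<^esub> g = Zero C Y (Cod C f) \<longrightarrow>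
      (\<exists>!h. h \<in> Mor C Y (Dom C k) \<and> k \<cdot>\<^bsub>C\<^esub> h = g))"

definition is_cokernel :: "('o, 'm, 'z) preadd_category_scheme \<Rightarrow> 'm \<Rightarrow> 'm \<Rightarrow> bool" where
  "is_cokernel C f q \<longleftrightarrow> f \<in> Arr C \<and> q \<in> Arr C \<and> Dom C q = Cod C f \<and>
    q \<cdot>\<^bsub>C\<^esub> f = Zero C (Dom C f) (Cod C q) \<and>
    (\<forall>Y\<in>Obj C. \<forall>g\<in>Mor C (Cod C f) Y. g \<cdot>\<^bsub>C\<^esub> f = Zero C (Dom C f) Y \<longrightarrow>
      (\<exists>!h. h \<in> Mor C (Cod C q) Y \<and> h \<cdot>\<^bsub>C\<^esub> q = g))"

definition is_mono :: "('o, 'm, 'z) category_scheme \<Rightarrow> 'm \<Rightarrow> bool" where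
  "is_mono C f \<longleftrightarrow> f \<in> Arr C \<and>
    (\<forall>Y\<in>Obj C. inj_on (\<lambda>g. f \<cdot>\<^bsub>C\<^esub> g) (Mor C Y (Dom C f)))"

definition is_epi :: "('o, 'm, 'z) category_scheme \<Rightarrow> 'm \<Rightarrow> bool" where
  "is_epi C f \<longleftrightarrow> f \<in> Arr C \<and>
    (\<forall>Y\<in>Obj C. inj_on (\<lambda>g. g \<cdot>\<^bsub>C\<^esub> f) (Mor C (Cod C f) Y))"

locale abelian_category = preadditive_category C
  for C :: "('o, 'm, 'z) preadd_category_scheme" (structure) +
  assumes ex_zero_object: "\<exists>z. is_zero_object C z"
    and ex_binary_product: "\<lbrakk>a \<in> Obj C; b \<in> Obj C\<rbrakk> \<Longrightarrow>
      \<exists>P pr. is_product C (UNIV :: bool set) (\<lambda>t. if t then a else b) P pr"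
    and ex_kernel: "f \<in> Arr C \<Longrightarrow> \<exists>k. is_kernel C f k"
    and ex_cokernel: "f \<in> Arr C \<Longrightarrow> \<exists>q. is_cokernel C f q"
    and mono_is_kernel: "is_mono C m \<Longrightarrow> \<exists>f. is_kernel C f m"
    and epi_is_cokernel: "is_epi C e \<Longrightarrow> \<exists>f. is_cokernel C f e"

text \<open>\<open>0 \<rightarrow> a \<rightarrow> b \<rightarrow> c \<rightarrow> 0\<close> is exact, with \<open>f : a \<rightarrow> b\<close> and \<open>g : b \<rightarrow> c\<close>.\<close>

definition short_exact :: "('o, 'm, 'z) preadd_category_scheme \<Rightarrow> 'm \<Rightarrow> 'm \<Rightarrow> bool" where
  "short_exact C f g \<longleftrightarrow> is_kernel C g f \<and> is_cokernel C f g"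

section \<open>Generators, small sums, exact small products, local objects\<close>

text \<open>Faithfulness of the functor represented by \<open>G\<close>, which sends \<open>f\<close> to postcomposition with \<open>f\<close>.\<close>

definition generator :: "('o, 'm, 'z) category_scheme \<Rightarrow> 'o \<Rightarrow> bool" where
  "generator C G \<longleftrightarrow> G \<in> Obj C \<and>
    (\<forall>a\<in>Obj C. \<forall>b\<in>Obj C. inj_on (\<lambda>f. \<lambda>h\<in>Mor C G a. f \<cdot>\<^bsub>C\<^esub> h) (Mor C a b))"

text \<open>
  Smallness of index sets is a parameter; the sets of a Grothendieck universe are one instance.
  Calling every set of the index type small would be too restrictive for large index types: a
  category with products indexed by a set as large as its class of morphisms is a preorder.
  Closure under power sets and unions is not imposed, because with an infinite small set it
  would require an inaccessible cardinal, whose existence HOL cannot prove.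
\<close>

definition smallness :: "('i set \<Rightarrow> bool) \<Rightarrow> bool" where
  "smallness small \<longleftrightarrow> (\<forall>I J. small J \<and> I \<lesssim> J \<longrightarrow> small I) \<and> (\<exists>I. small I \<and> infinite I)"

definition has_small_sums :: "('i set \<Rightarrow> bool) \<Rightarrow> ('o, 'm, 'z) category_scheme \<Rightarrow> bool" where
  "has_small_sums small C \<longleftrightarrow>
    (\<forall>I X. small I \<and> (\<forall>i\<in>I. X i \<in> Obj C) \<longrightarrow> (\<exists>Q em. is_coproduct C I X Q em))"

definition has_small_products :: "('i set \<Rightarrow> bool) \<Rightarrow> ('o, 'm, 'z) category_scheme \<Rightarrow> bool" where
  "has_small_products small C \<longleftrightarrow>
    (\<forall>I X. small I \<and> (\<forall>i\<in>I. X i \<in> Obj C) \<longrightarrow> (\<exists>P pr. is_product C I X P pr))"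

definition small_products_exact ::
  "('i set \<Rightarrow> bool) \<Rightarrow> ('o, 'm, 'z) preadd_category_scheme \<Rightarrow> bool" where
  "small_products_exact small C \<longleftrightarrow>
    (\<forall>I X Y Z f g PX pX PY pY PZ pZ f' g'.
      small I \<and>
      (\<forall>i\<in>I. f i \<in> Mor C (X i) (Y i) \<and> g i \<in> Mor C (Y i) (Z i) \<and> short_exact C (f i) (g i)) \<and>
      is_product C I X PX pX \<and> is_product C I Y PY pY \<and> is_product C I Z PZ pZ \<and>
      f' \<in> Mor C PX PY \<and> (\<forall>i\<in>I. pY i \<cdot>\<^bsub>C\<^esub> f' = f i \<cdot>\<^bsub>C\<^esub> pX i) \<and>
      g' \<in> Mor C PY PZ \<and> (\<forall>i\<in>I. pZ i \<cdot>\<^bsub>C\<^esub> g' = g i \<cdot>\<^bsub>C\<^esub> pY i)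
      \<longrightarrow> short_exact C f' g')"

definition local_object :: "('o, 'm, 'z) category_scheme \<Rightarrow> 'm \<Rightarrow> 'o \<Rightarrow> bool" where
  "local_object C \<theta> l \<longleftrightarrow>
    bij_betw (\<lambda>h. h \<cdot>\<^bsub>C\<^esub> \<theta>) (Mor C (Cod C \<theta>) l) (Mor C (Dom C \<theta>) l)"

section \<open>The category of inverse sequences\<close>

datatype ('o, 'm) inv_seq = Inv_Seq (obs: "nat \<Rightarrow> 'o") (bonds: "nat \<Rightarrow> 'm")

datatype ('o, 'm) seq_mor =
  Seq_Mor (src: "('o, 'm) inv_seq") (tgt: "('o, 'm) inv_seq") (comps: "nat \<Rightarrow> 'm")

definition inverse_sequence :: "('o, 'm, 'z) category_scheme \<Rightarrow> ('o, 'm) inv_seq \<Rightarrow> bool" where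
  "inverse_sequence C S \<longleftrightarrow>
    (\<forall>i. obs S i \<in> Obj C \<and> bonds S i \<in> Mor C (obs S (Suc i)) (obs S i))"

definition sequence_morphism :: "('o, 'm, 'z) category_scheme \<Rightarrow> ('o, 'm) seq_mor \<Rightarrow> bool" where
  "sequence_morphism C \<phi> \<longleftrightarrow>
    inverse_sequence C (src \<phi>) \<and> inverse_sequence C (tgt \<phi>) \<and>
    (\<forall>i. comps \<phi> i \<in> Mor C (obs (src \<phi>) i) (obs (tgt \<phi>) i) \<and>
      comps \<phi> i \<cdot>\<^bsub>C\<^esub> bonds (src \<phi>) i = bonds (tgt \<phi>) i \<cdot>\<^bsub>C\<^esub> comps \<phi> (Suc i))"

definition inv_seq_cat :: "('o, 'm, 'z) preadd_category_scheme \<Rightarrow>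
    (('o, 'm) inv_seq, ('o, 'm) seq_mor) preadd_category" where
  "inv_seq_cat C = \<lparr>
    Obj = {S. inverse_sequence C S},
    Arr = {\<phi>. sequence_morphism C \<phi>},
    Dom = src,
    Cod = tgt,
    Idt = (\<lambda>S. Seq_Mor S S (\<lambda>i. Idt C (obs S i))),
    Comp = (\<lambda>\<psi> \<phi>. Seq_Mor (src \<phi>) (tgt \<psi>) (\<lambda>i. comps \<psi> i \<cdot>\<^bsub>C\<^esub> comps \<phi> i)),
    Add = (\<lambda>\<phi> \<psi>. Seq_Mor (src \<phi>) (tgt \<phi>) (\<lambda>i. Add C (comps \<phi> i) (comps \<psi> i))),
    Zero = (\<lambda>S T. Seq_Mor S T (\<lambda>i. Zero C (obs S i) (obs T i)))\<rparr>"

section \<open>Limit, first derived limit and local inverse sequences\<close>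

definition seq_product :: "('o, 'm, 'z) category_scheme \<Rightarrow> ('o, 'm) inv_seq \<Rightarrow> 'o \<times> (nat \<Rightarrow> 'm)" where
  "seq_product C S = (SOME (P, pr). is_product C UNIV (obs S) P pr)"

definition seq_shift :: "('o, 'm, 'z) category_scheme \<Rightarrow> ('o, 'm) inv_seq \<Rightarrow> 'm" where
  "seq_shift C S = (let (P, pr) = seq_product C S in
    THE F. F \<in> Mor C P P \<and> (\<forall>j. pr j \<cdot>\<^bsub>C\<^esub> F = bonds S j \<cdot>\<^bsub>C\<^esub> pr (Suc j)))"

definition one_minus_shift :: "('o, 'm, 'z) preadd_category_scheme \<Rightarrow> ('o, 'm) inv_seq \<Rightarrow> 'm" where
  "one_minus_shift C S = mor_diff C (Idt C (fst (seq_product C S))) (seq_shift C S)"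

definition lim_obj :: "('o, 'm, 'z) preadd_category_scheme \<Rightarrow> ('o, 'm) inv_seq \<Rightarrow> 'o" where
  "lim_obj C S = Dom C (SOME k. is_kernel C (one_minus_shift C S) k)"

definition lim1_obj :: "('o, 'm, 'z) preadd_category_scheme \<Rightarrow> ('o, 'm) inv_seq \<Rightarrow> 'o" where
  "lim1_obj C S = Cod C (SOME q. is_cokernel C (one_minus_shift C S) q)"

definition local_sequence :: "('o, 'm, 'z) preadd_category_scheme \<Rightarrow> ('o, 'm) inv_seq \<Rightarrow> bool" where
  "local_sequence C S \<longleftrightarrow> is_zero_object C (lim_obj C S) \<and> is_zero_object C (lim1_obj C S)"

section \<open>The sequence \<open>G\<^sup>~\<close> and the endomorphism \<open>I\<close>\<close>

definition zero_obj :: "('o, 'm, 'z) category_scheme \<Rightarrow> 'o" where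
  "zero_obj C = (SOME z. is_zero_object C z)"

definition trunc_ob :: "('o, 'm, 'z) category_scheme \<Rightarrow> 'o \<Rightarrow> nat \<Rightarrow> nat \<Rightarrow> 'o" where
  "trunc_ob C G n i = (if i \<le> n then G else zero_obj C)"

definition trunc_seq :: "('o, 'm, 'z) preadd_category_scheme \<Rightarrow> 'o \<Rightarrow> nat \<Rightarrow> ('o, 'm) inv_seq" where
  "trunc_seq C G n = Inv_Seq (trunc_ob C G n)
    (\<lambda>i. if i < n then Idt C G else Zero C (trunc_ob C G n (Suc i)) (trunc_ob C G n i))"

definition trunc_incl :: "('o, 'm, 'z) preadd_category_scheme \<Rightarrow> 'o \<Rightarrow> nat \<Rightarrow> ('o, 'm) seq_mor" where
  "trunc_incl C G n = Seq_Mor (trunc_seq C G n) (trunc_seq C G (Suc n))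
    (\<lambda>i. if i \<le> n then Idt C G else Zero C (trunc_ob C G n i) (trunc_ob C G (Suc n) i))"

text \<open>The direct sum \<open>G\<^sup>~\<close>, formed in the category of inverse sequences, with its embeddings.\<close>

definition G_tilde :: "('o, 'm, 'z) preadd_category_scheme \<Rightarrow> 'o \<Rightarrow>
    ('o, 'm) inv_seq \<times> (nat \<Rightarrow> ('o, 'm) seq_mor)" where
  "G_tilde C G = (SOME (Q, em). is_coproduct (inv_seq_cat C) UNIV (trunc_seq C G) Q em)"

definition G_tilde_shift :: "('o, 'm, 'z) preadd_category_scheme \<Rightarrow> 'o \<Rightarrow> ('o, 'm) seq_mor" where
  "G_tilde_shift C G = (let (Q, em) = G_tilde C G in
    THE I. I \<in> Mor (inv_seq_cat C) Q Q \<and>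
      (\<forall>n. I \<cdot>\<^bsub>inv_seq_cat C\<^esub> em n = em (Suc n) \<cdot>\<^bsub>inv_seq_cat C\<^esub> trunc_incl C G n))"

definition one_minus_G_tilde_shift ::
  "('o, 'm, 'z) preadd_category_scheme \<Rightarrow> 'o \<Rightarrow> ('o, 'm) seq_mor" where
  "one_minus_G_tilde_shift C G =
    mor_diff (inv_seq_cat C) (Idt (inv_seq_cat C) (fst (G_tilde C G))) (G_tilde_shift C G)"

end

theory Submission
  imports Defs
begin

text \<open>
  Let \<open>P\<close> be the product of the objects \<open>S\<^sub>n\<close>. A morphism \<open>G(n) \<rightarrow> S\<close> is determined by its
  component \<open>G \<rightarrow> S\<^sub>n\<close>, which is arbitrary. Hence the morphisms \<open>G\<^sup>~ \<rightarrow> S\<close> and the morphisms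
  \<open>G \<rightarrow> P\<close> both correspond to the families \<open>x\<^sub>n : G \<rightarrow> S\<^sub>n\<close>, and under these correspondences
  precomposition with \<open>1 - I\<close> and postcomposition with \<open>1 - F\<close> both become the map sending
  \<open>x\<close> to the family \<open>x\<^sub>n - f\<^sub>n x\<^sub>n\<^sub>+\<^sub>1\<close>. So \<open>S\<close> is \<open>(1 - I)\<close>-local if and only if \<open>1 - F\<close> induces a
  bijection on the morphisms \<open>G \<rightarrow> P\<close>. As \<open>G\<close> is a generator, this says that the kernel and
  the cokernel of \<open>1 - F\<close> vanish.
\<close>

section \<open>Preadditive categories\<close>

lemma mor_group_simps [simp]:
  "carrier (mor_group C a b) = Mor C a b"
  "monoid.mult (mor_group C a b) = Add C"
  "one (mor_group C a b) = Zero C a b"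
  by (simp_all add: mor_group_def)

lemma (in category) Mor_objs:
  assumes "f \<in> Mor C a b"
  shows "a \<in> Obj C" "b \<in> Obj C"
  using assms dom_obj cod_obj by (auto simp: Mor_def)

context preadditive_category
begin

lemma zero_mor:
  assumes "a \<in> Obj C" "b \<in> Obj C"
  shows "Zero C a b \<in> Mor C a b"
proof -
  interpret M: comm_group "mor_group C a b" by (rule mor_comm_group[OF assms])
  show ?thesis using M.one_closed by simp
qed

lemma mor_group_of_mor: "f \<in> Mor C a b \<Longrightarrow> comm_group (mor_group C a b)"
  using Mor_objs mor_comm_group by blast

lemma add_mor:
  assumes "f \<in> Mor C a b" "g \<in> Mor C a b"
  shows "Add C f g \<in> Mor C a b"
proof -
  interpret M: comm_group "mor_group C a b"
    using assms mor_group_of_mor by blast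
  show ?thesis using M.m_closed[of f g] assms by simp
qed

section \<open>Differences of morphisms\<close>

lemma mor_diff_alt:
  "g \<in> Mor C a b \<Longrightarrow> mor_diff C f g = Add C f (inv\<^bsub>mor_group C a b\<^esub> g)"
  by (simp add: mor_diff_def Mor_def)

lemma mor_diff_mor:
  assumes "f \<in> Mor C a b" "g \<in> Mor C a b"
  shows "mor_diff C f g \<in> Mor C a b"
proof -
  interpret M: comm_group "mor_group C a b"
    using assms mor_group_of_mor by blast
  show ?thesis using M.inv_closed[of g] assms by (simp add: mor_diff_alt add_mor)
qed

lemma mor_diff_add:
  assumes "f \<in> Mor C a b" "g \<in> Mor C a b"
  shows "Add C (mor_diff C f g) g = f"
proof -
  interpret M: comm_group "mor_group C a b"
    using assms mor_group_of_mor by blast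
  show ?thesis
    using M.m_assoc[of f "inv\<^bsub>mor_group C a b\<^esub> g" g] M.l_inv[of g] M.r_one[of f]
      M.inv_closed[of g] assms
    by (simp add: mor_diff_alt)
qed

text \<open>Right cancellation in the group of morphisms: a difference is recognised by adding
  \<open>g\<close> back. Together with \<open>mor_diff_add\<close> this lets the later computations
  with differences avoid inverses.\<close>

lemma mor_diff_eqI:
  assumes "r \<in> Mor C a b" "g \<in> Mor C a b" "Add C r g = f"
  shows "mor_diff C f g = r"
proof -
  interpret M: comm_group "mor_group C a b"
    using assms mor_group_of_mor by blast
  have "f \<in> Mor C a b" using assms add_mor by blast
  then show ?thesis
    using M.right_cancel[of g "mor_diff C f g" r] assms by (simp add: mor_diff_add mor_diff_mor)
qed

lemma comp_diff:
  assumes f: "f \<in> Mor C a b" and g: "g \<in> Mor C a b" and h: "h \<in> Mor C b c"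
  shows "h \<cdot> mor_diff C f g = mor_diff C (h \<cdot> f) (h \<cdot> g)"
proof (rule mor_diff_eqI[symmetric])
  show "h \<cdot> mor_diff C f g \<in> Mor C a c" by (rule comp_mor[OF mor_diff_mor[OF f g] h])
  show "h \<cdot> g \<in> Mor C a c" by (rule comp_mor[OF g h])
  show "Add C (h \<cdot> mor_diff C f g) (h \<cdot> g) = h \<cdot> f"
    using comp_add[OF mor_diff_mor[OF f g] g h] mor_diff_add[OF f g] by simp
qed

lemma diff_comp:
  assumes f: "f \<in> Mor C b c" and g: "g \<in> Mor C b c" and h: "h \<in> Mor C a b"
  shows "mor_diff C f g \<cdot> h = mor_diff C (f \<cdot> h) (g \<cdot> h)"
proof (rule mor_diff_eqI[symmetric])
  show "mor_diff C f g \<cdot> h \<in> Mor C a c" by (rule comp_mor[OF h mor_diff_mor[OF f g]])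
  show "g \<cdot> h \<in> Mor C a c" by (rule comp_mor[OF h g])
  show "Add C (mor_diff C f g \<cdot> h) (g \<cdot> h) = f \<cdot> h"
    using add_comp[OF mor_diff_mor[OF f g] g h] mor_diff_add[OF f g] by simp
qed

lemma add_zero_left:
  assumes "f \<in> Mor C a b"
  shows "Add C (Zero C a b) f = f"
proof -
  interpret M: comm_group "mor_group C a b"
    using assms mor_group_of_mor by blast
  show ?thesis using M.l_one[of f] assms by simp
qed

lemma mor_diff_self: "f \<in> Mor C a b \<Longrightarrow> mor_diff C f f = Zero C a b"
  by (rule mor_diff_eqI[OF zero_mor[OF Mor_objs] _ add_zero_left])

lemma mor_diff_zeroD:
  assumes "f \<in> Mor C a b" "g \<in> Mor C a b" "mor_diff C f g = Zero C a b"
  shows "f = g"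
  using mor_diff_add[OF assms(1,2)] add_zero_left[OF assms(2)] assms(3) by simp

text \<open>Zero is the difference of a morphism with itself, and \<open>comp_diff\<close> turns the
  composite into such a difference again.\<close>

lemma comp_zero:
  assumes "h \<in> Mor C b c" "a \<in> Obj C"
  shows "h \<cdot> Zero C a b = Zero C a c"
proof -
  have z: "Zero C a b \<in> Mor C a b" using assms Mor_objs zero_mor by blast
  have "h \<cdot> mor_diff C (Zero C a b) (Zero C a b) = Zero C a c"
    using comp_diff[OF z z assms(1)] mor_diff_self[OF comp_mor[OF z assms(1)]] by simp
  then show ?thesis by (simp add: mor_diff_self[OF z])
qed

lemma zero_comp:
  assumes "h \<in> Mor C a b" "c \<in> Obj C"
  shows "Zero C b c \<cdot> h = Zero C a c"
proof -
  have z: "Zero C b c \<in> Mor C b c" using assms Mor_objs zero_mor by blast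
  have "mor_diff C (Zero C b c) (Zero C b c) \<cdot> h = Zero C a c"
    using diff_comp[OF z z assms(1)] mor_diff_self[OF comp_mor[OF assms(1) z]] by simp
  then show ?thesis by (simp add: mor_diff_self[OF z])
qed

section \<open>Zero objects, kernels and cokernels\<close>

lemma zero_objectI:
  assumes "a \<in> Obj C" "Idt C a = Zero C a a"
  shows "is_zero_object C a"
  unfolding is_zero_object_def
proof (intro conjI ballI)
  fix b assume b: "b \<in> Obj C"
  have "f = Zero C a b" if "f \<in> Mor C a b" for f
    using comp_idt[OF that] comp_zero[OF that assms(1)] assms(2) by simp
  then show "\<exists>!f. f \<in> Mor C a b" using zero_mor[OF assms(1) b] by blast
  have "f = Zero C b a" if "f \<in> Mor C b a" for f
    using idt_comp[OF that] zero_comp[OF that assms(1)] assms(2) by simp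
  then show "\<exists>!f. f \<in> Mor C b a" using zero_mor[OF b assms(1)] by blast
qed (rule assms(1))

lemma zero_object_mor_eq:
  assumes z: "is_zero_object C z"
  shows "f \<in> Mor C z a \<Longrightarrow> f = Zero C z a" "f \<in> Mor C a z \<Longrightarrow> f = Zero C a z"
proof -
  show "f = Zero C z a" if f: "f \<in> Mor C z a"
    using z f Mor_objs(2)[OF f] zero_mor[OF Mor_objs[OF f]]
    by (auto simp: is_zero_object_def)
  show "f = Zero C a z" if f: "f \<in> Mor C a z"
    using z f Mor_objs(1)[OF f] zero_mor[OF Mor_objs[OF f]]
    by (auto simp: is_zero_object_def)
qed

lemma is_kernel_props:
  assumes "is_kernel C d k" "d \<in> Mor C a b"
  shows "Dom C k \<in> Obj C" "k \<in> Mor C (Dom C k) a" "d \<cdot> k = Zero C (Dom C k) b"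
    "\<And>g Y. g \<in> Mor C Y a \<Longrightarrow> d \<cdot> g = Zero C Y b \<Longrightarrow>
      \<exists>!h. h \<in> Mor C Y (Dom C k) \<and> k \<cdot> h = g"
proof -
  show "Dom C k \<in> Obj C" "k \<in> Mor C (Dom C k) a" "d \<cdot> k = Zero C (Dom C k) b"
    using assms dom_obj unfolding is_kernel_def Mor_def by auto
  show "\<exists>!h. h \<in> Mor C Y (Dom C k) \<and> k \<cdot> h = g"
    if "g \<in> Mor C Y a" "d \<cdot> g = Zero C Y b" for g Y
  proof -
    have "Dom C d = a" "Cod C d = b" using assms by (auto simp: Mor_def)
    then show ?thesis using assms(1) that Mor_objs(1)[OF that(1)] unfolding is_kernel_def by simp
  qed
qed

lemma is_cokernel_props:
  assumes "is_cokernel C d q" "d \<in> Mor C a b"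
  shows "Cod C q \<in> Obj C" "q \<in> Mor C b (Cod C q)" "q \<cdot> d = Zero C a (Cod C q)"
    "\<And>g Y. g \<in> Mor C b Y \<Longrightarrow> g \<cdot> d = Zero C a Y \<Longrightarrow>
      \<exists>!h. h \<in> Mor C (Cod C q) Y \<and> h \<cdot> q = g"
proof -
  show "Cod C q \<in> Obj C" "q \<in> Mor C b (Cod C q)" "q \<cdot> d = Zero C a (Cod C q)"
    using assms cod_obj unfolding is_cokernel_def Mor_def by auto
  show "\<exists>!h. h \<in> Mor C (Cod C q) Y \<and> h \<cdot> q = g"
    if "g \<in> Mor C b Y" "g \<cdot> d = Zero C a Y" for g Y
  proof -
    have "Dom C d = a" "Cod C d = b" using assms by (auto simp: Mor_def)
    then show ?thesis using assms(1) that Mor_objs(2)[OF that(1)] unfolding is_cokernel_def by simp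
  qed
qed

text \<open>The difference of \<open>f\<close> and \<open>g\<close> is killed by \<open>d\<close>,
  so it factors through the kernel. A factorization through a zero object is zero.\<close>

lemma zero_kernel_cancel:
  assumes k: "is_kernel C d k" "is_zero_object C (Dom C k)" and d: "d \<in> Mor C a b"
    and fg: "f \<in> Mor C c a" "g \<in> Mor C c a" "d \<cdot> f = d \<cdot> g"
  shows "f = g"
proof -
  have "d \<cdot> mor_diff C f g = Zero C c b"
    using comp_diff[OF fg(1,2) d] mor_diff_self[OF comp_mor[OF fg(2) d]] fg(3) by simp
  then obtain h where h: "h \<in> Mor C c (Dom C k)" "k \<cdot> h = mor_diff C f g"
    using is_kernel_props(4)[OF k(1) d] mor_diff_mor[OF fg(1,2)] by blast
  have "mor_diff C f g = Zero C c a"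
    using h zero_object_mor_eq(2)[OF k(2) h(1)] comp_zero[OF is_kernel_props(2)[OF k(1) d]]
      Mor_objs(1)[OF h(1)] by simp
  then show ?thesis using mor_diff_zeroD fg by blast
qed

text \<open>Dually, the difference of \<open>f\<close> and \<open>g\<close> kills \<open>d\<close>
  and factors through the cokernel, a zero object.\<close>

lemma zero_cokernel_cancel:
  assumes q: "is_cokernel C d q" "is_zero_object C (Cod C q)" and d: "d \<in> Mor C a b"
    and fg: "f \<in> Mor C b c" "g \<in> Mor C b c" "f \<cdot> d = g \<cdot> d"
  shows "f = g"
proof -
  have "mor_diff C f g \<cdot> d = Zero C a c"
    using diff_comp[OF fg(1,2) d] mor_diff_self[OF comp_mor[OF d fg(2)]] fg(3) by simp
  then obtain h where h: "h \<in> Mor C (Cod C q) c" "h \<cdot> q = mor_diff C f g"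
    using is_cokernel_props(4)[OF q(1) d] mor_diff_mor[OF fg(1,2)] by blast
  have "mor_diff C f g = Zero C b c"
    using h zero_object_mor_eq(1)[OF q(2) h(1)] zero_comp[OF is_cokernel_props(2)[OF q(1) d]]
      Mor_objs(2)[OF h(1)] by simp
  then show ?thesis using mor_diff_zeroD fg by blast
qed

end

section \<open>Testing on morphisms out of a generator\<close>

lemma generator_eqI:
  assumes "generator C G" "a \<in> Obj C" "b \<in> Obj C" "f \<in> Mor C a b" "g \<in> Mor C a b"
    and "\<And>h. h \<in> Mor C G a \<Longrightarrow> f \<cdot>\<^bsub>C\<^esub> h = g \<cdot>\<^bsub>C\<^esub> h"
  shows "f = g"
proof -
  have "inj_on (\<lambda>f. \<lambda>h\<in>Mor C G a. f \<cdot>\<^bsub>C\<^esub> h) (Mor C a b)"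
    using assms(1-3) by (auto simp: generator_def)
  moreover have "(\<lambda>h\<in>Mor C G a. f \<cdot>\<^bsub>C\<^esub> h) = (\<lambda>h\<in>Mor C G a. g \<cdot>\<^bsub>C\<^esub> h)"
    using assms(6) by (auto simp: restrict_def)
  ultimately show ?thesis using assms(4,5) by (auto dest: inj_onD)
qed

text \<open>If kernel and cokernel vanish, then \<open>d\<close> is a monomorphism, hence a kernel,
  and this produces a two-sided inverse on morphisms out of \<open>G\<close>. Conversely,
  injectivity on these morphisms kills the kernel and surjectivity kills the cokernel, because
  \<open>G\<close> detects equality of morphisms.\<close>

lemma (in abelian_category) zero_kernel_cokernel_iff:
  assumes G: "generator C G" and d: "d \<in> Mor C a b"
    and k: "is_kernel C d k" and q: "is_cokernel C d q"
  shows "is_zero_object C (Dom C k) \<and> is_zero_object C (Cod C q) \<longleftrightarrow>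
    bij_betw (\<lambda>h. d \<cdot> h) (Mor C G a) (Mor C G b)"
proof
  assume z: "is_zero_object C (Dom C k) \<and> is_zero_object C (Cod C q)"
  have dab: "d \<in> Arr C" "Dom C d = a" "Cod C d = b" using d by (auto simp: Mor_def)
  note b = Mor_objs(2)[OF d]
  have cancel: "f = g" if "f \<in> Mor C c a" "g \<in> Mor C c a" "d \<cdot> f = d \<cdot> g" for f g c
    using zero_kernel_cancel[OF k _ d that] z by blast
  then have "is_mono C d"
    using dab by (auto simp: is_mono_def inj_on_def)
  \<comment> \<open>The axiom that monomorphisms are kernels enters here. The plan is to show that
    \<open>f\<close> is zero, so that everything factors through its kernel
    \<open>d\<close>.\<close>
  then obtain f where f: "is_kernel C f d" using mono_is_kernel by blast
  define c where "c = Cod C f"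
  have fbc: "f \<in> Mor C b c" and fd: "f \<cdot> d = Zero C a c"
    using f dab by (auto simp: is_kernel_def Mor_def c_def)
  note c = Mor_objs(2)[OF fbc]
  \<comment> \<open>Both sides agree after precomposition with \<open>d\<close>, which can be
    cancelled because the cokernel of \<open>d\<close> vanishes.\<close>
  have "f = Zero C b c"
    using zero_cokernel_cancel[OF q _ d fbc zero_mor[OF b c]] z fd zero_comp[OF d c] by simp
  then have "f \<cdot> Idt C b = Zero C b c" using comp_idt[OF fbc] by simp
  \<comment> \<open>As \<open>f\<close> is zero it kills the identity of \<open>b\<close>, which
    therefore factors through the kernel \<open>d\<close> of \<open>f\<close>. The factorization
    \<open>s\<close> is a right inverse of \<open>d\<close>.\<close>
  then obtain s where s: "s \<in> Mor C b a" "d \<cdot> s = Idt C b"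
    using is_kernel_props(4)[OF f fbc idt_mor[OF b]] dab by auto
  show "bij_betw (\<lambda>h. d \<cdot> h) (Mor C G a) (Mor C G b)"
  proof (rule bij_betwI[where g = "\<lambda>h. s \<cdot> h"])
    show "(\<lambda>h. d \<cdot> h) \<in> Mor C G a \<rightarrow> Mor C G b" "(\<lambda>h. s \<cdot> h) \<in> Mor C G b \<rightarrow> Mor C G a"
      using comp_mor d s(1) by blast+
    show r: "d \<cdot> (s \<cdot> y) = y" if "y \<in> Mor C G b" for y
      using comp_assoc[OF that s(1) d] s(2) idt_comp[OF that] by simp
    \<comment> \<open>Composing both sides with \<open>d\<close> gives \<open>d \<cdot> x\<close>,
      by \<open>r\<close>; then \<open>d\<close> is cancelled.\<close>
    show "s \<cdot> (d \<cdot> x) = x" if "x \<in> Mor C G a" for x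
      by (rule cancel[OF _ that]) (use that r comp_mor d s(1) in blast)+
  qed
next
  assume bij: "bij_betw (\<lambda>h. d \<cdot> h) (Mor C G a) (Mor C G b)"
  have GO: "G \<in> Obj C" using G by (simp add: generator_def)
  note K = is_kernel_props[OF k d] and Q = is_cokernel_props[OF q d]
  note a = Mor_objs(1)[OF d] and b = Mor_objs(2)[OF d]
  have "Idt C (Dom C k) = Zero C (Dom C k) (Dom C k)"
  proof (rule generator_eqI[OF G K(1) K(1) idt_mor[OF K(1)] zero_mor[OF K(1) K(1)]])
    fix x assume x: "x \<in> Mor C G (Dom C k)"
    have "d \<cdot> (k \<cdot> x) = d \<cdot> Zero C G a"
      using comp_assoc[OF x K(2) d] K(3) zero_comp[OF x b] comp_zero[OF d GO] by simp
    then have "k \<cdot> x = Zero C G a"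
      using inj_onD[OF bij_betw_imp_inj_on[OF bij]] comp_mor[OF x K(2)] zero_mor[OF GO a] by blast
    \<comment> \<open>Both \<open>x\<close> and zero are factorizations of the zero morphism through
      \<open>k\<close>, and such a factorization is unique.\<close>
    then have "x = Zero C G (Dom C k)"
      using K(4)[OF zero_mor[OF GO a] comp_zero[OF d GO]] x zero_mor[OF GO K(1)]
        comp_zero[OF K(2) GO] by blast
    then show "Idt C (Dom C k) \<cdot> x = Zero C (Dom C k) (Dom C k) \<cdot> x"
      using idt_comp[OF x] zero_comp[OF x K(1)] by simp
  qed
  \<comment> \<open>Every \<open>x\<close> out of \<open>G\<close> has the form
    \<open>d \<cdot> y\<close>, and \<open>q\<close> kills \<open>d\<close>.\<close>
  moreover have "q = Zero C b (Cod C q)"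
  proof (rule generator_eqI[OF G b Q(1) Q(2) zero_mor[OF b Q(1)]])
    fix x assume x: "x \<in> Mor C G b"
    then obtain y where y: "y \<in> Mor C G a" "d \<cdot> y = x"
      unfolding bij_betw_imp_surj_on[OF bij, symmetric] by blast
    show "q \<cdot> x = Zero C b (Cod C q) \<cdot> x"
      using comp_assoc[OF y(1) d Q(2)]
      unfolding y(2) Q(3) zero_comp[OF y(1) Q(1)] zero_comp[OF x Q(1)] .
  qed
  then have "Idt C (Cod C q) \<cdot> q = Zero C b (Cod C q)"
    by (rule trans[OF idt_comp[OF Q(2)]])
  \<comment> \<open>The identity and the zero endomorphism both factor the zero morphism through
    \<open>q\<close>, so uniqueness makes them equal.\<close>
  then have "Idt C (Cod C q) = Zero C (Cod C q) (Cod C q)"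
    using Q(4)[OF zero_mor[OF b Q(1)] zero_comp[OF d Q(1)]] idt_mor[OF Q(1)]
      zero_mor[OF Q(1) Q(1)] zero_comp[OF Q(2) Q(1)] by blast
  ultimately show "is_zero_object C (Dom C k) \<and> is_zero_object C (Cod C q)"
    using zero_objectI K(1) Q(1) by blast
qed

section \<open>Products and coproducts\<close>

lemma is_productD:
  assumes "is_product C I X P pr"
  shows "P \<in> Obj C" "i \<in> I \<Longrightarrow> pr i \<in> Mor C P (X i)"
    "\<lbrakk>Y \<in> Obj C; \<And>i. i \<in> I \<Longrightarrow> g i \<in> Mor C Y (X i)\<rbrakk> \<Longrightarrow>
      \<exists>!h. h \<in> Mor C Y P \<and> (\<forall>i\<in>I. pr i \<cdot>\<^bsub>C\<^esub> h = g i)"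
  using assms unfolding is_product_def by blast+

lemma is_coproductD:
  assumes "is_coproduct C I X Q em"
  shows "Q \<in> Obj C" "i \<in> I \<Longrightarrow> em i \<in> Mor C (X i) Q"
    "\<lbrakk>Y \<in> Obj C; \<And>i. i \<in> I \<Longrightarrow> g i \<in> Mor C (X i) Y\<rbrakk> \<Longrightarrow>
      \<exists>!h. h \<in> Mor C Q Y \<and> (\<forall>i\<in>I. h \<cdot>\<^bsub>C\<^esub> em i = g i)"
  using assms unfolding is_coproduct_def by blast+

text \<open>Smallness concerns sets over an arbitrary index type, while sequences are indexed by
  \<open>nat\<close>. A family is copied to \<open>range j\<close>, with \<open>inv_into\<close>
  recovering the original index, and the product is carried back along \<open>j\<close>.\<close>

lemma is_product_reindex:
  fixes j :: "'a \<Rightarrow> 'b"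
  assumes "inj j" "is_product C (range j) (\<lambda>i. X (inv_into UNIV j i)) P pr"
  shows "is_product C UNIV X P (pr \<circ> j)"
proof -
  note D = is_productD[OF assms(2)]
  have "\<exists>!h. h \<in> Mor C Y P \<and> (\<forall>i. pr (j i) \<cdot>\<^bsub>C\<^esub> h = g i)"
    if "Y \<in> Obj C" "\<forall>i. g i \<in> Mor C Y (X i)" for Y g
    using D(3)[OF that(1), of "g \<circ> inv_into UNIV j"] that(2) by (simp add: assms(1))
  then show ?thesis
    using D(1) D(2)[of "j _"] by (auto simp: is_product_def assms(1))
qed

lemma is_coproduct_reindex:
  fixes j :: "'a \<Rightarrow> 'b"
  assumes "inj j" "is_coproduct C (range j) (\<lambda>i. X (inv_into UNIV j i)) P em"
  shows "is_coproduct C UNIV X P (em \<circ> j)"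
proof -
  note D = is_coproductD[OF assms(2)]
  have "\<exists>!h. h \<in> Mor C P Y \<and> (\<forall>i. h \<cdot>\<^bsub>C\<^esub> em (j i) = g i)"
    if "Y \<in> Obj C" "\<forall>i. g i \<in> Mor C (X i) Y" for Y g
    using D(3)[OF that(1), of "g \<circ> inv_into UNIV j"] that(2) by (simp add: assms(1))
  then show ?thesis
    using D(1) D(2)[of "j _"] by (auto simp: is_coproduct_def assms(1))
qed

text \<open>Some small set is infinite, hence contains a copy of the natural numbers, and smallness
  passes to sets of no larger cardinality.\<close>

lemma smallness_countable:
  assumes "smallness (small :: 'i set \<Rightarrow> bool)"
  obtains j :: "nat \<Rightarrow> 'i" where "inj j" "small (range j)"
proof -
  obtain I :: "'i set" where I: "small I" "infinite I"
    using assms by (auto simp: smallness_def)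
  obtain j :: "nat \<Rightarrow> 'i" where j: "inj j" "range j \<subseteq> I"
    using I(2) infinite_countable_subset by blast
  then have "small (range j)"
    using assms I(1) subset_imp_lepoll unfolding smallness_def by blast
  with j(1) show ?thesis by (rule that)
qed

section \<open>Existence of countable products and coproducts\<close>

lemma ex_countable_product:
  fixes X :: "nat \<Rightarrow> 'o" and small :: "'i set \<Rightarrow> bool"
  assumes "smallness small" "has_small_products small C" "\<And>n. X n \<in> Obj C"
  shows "\<exists>P pr. is_product C UNIV X P pr"
proof -
  obtain j :: "nat \<Rightarrow> 'i" where j: "inj j" "small (range j)" using smallness_countable[OF assms(1)] .
  then have "\<exists>P pr. is_product C (range j) (\<lambda>i. X (inv_into UNIV j i)) P pr"
    using assms(2,3) by (auto simp: has_small_products_def)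
  then show ?thesis using is_product_reindex[OF j(1), of C X] by blast
qed

lemma ex_countable_coproduct:
  fixes X :: "nat \<Rightarrow> 'o" and small :: "'i set \<Rightarrow> bool"
  assumes "smallness small" "has_small_sums small C" "\<And>n. X n \<in> Obj C"
  shows "\<exists>Q em. is_coproduct C UNIV X Q em"
proof -
  obtain j :: "nat \<Rightarrow> 'i" where j: "inj j" "small (range j)" using smallness_countable[OF assms(1)] .
  then have "\<exists>P em. is_coproduct C (range j) (\<lambda>i. X (inv_into UNIV j i)) P em"
    using assms(2,3) by (auto simp: has_small_sums_def)
  then show ?thesis using is_coproduct_reindex[OF j(1), of C X] by blast
qed

section \<open>The category of inverse sequences\<close>

lemma inv_seq_cat_simps [simp]:
  "Obj (inv_seq_cat C) = {S. inverse_sequence C S}"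
  "Arr (inv_seq_cat C) = {\<phi>. sequence_morphism C \<phi>}"
  "Dom (inv_seq_cat C) = src"
  "Cod (inv_seq_cat C) = tgt"
  "Idt (inv_seq_cat C) S = Seq_Mor S S (\<lambda>i. Idt C (obs S i))"
  "\<psi> \<cdot>\<^bsub>inv_seq_cat C\<^esub> \<phi> = Seq_Mor (src \<phi>) (tgt \<psi>) (\<lambda>i. comps \<psi> i \<cdot>\<^bsub>C\<^esub> comps \<phi> i)"
  "Add (inv_seq_cat C) \<phi> \<psi> = Seq_Mor (src \<phi>) (tgt \<phi>) (\<lambda>i. Add C (comps \<phi> i) (comps \<psi> i))"
  "Zero (inv_seq_cat C) S T = Seq_Mor S T (\<lambda>i. Zero C (obs S i) (obs T i))"
  by (simp_all add: inv_seq_cat_def)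

lemma Mor_inv_seq_cat_iff:
  "\<phi> \<in> Mor (inv_seq_cat C) S T \<longleftrightarrow>
    src \<phi> = S \<and> tgt \<phi> = T \<and> inverse_sequence C S \<and> inverse_sequence C T \<and>
    (\<forall>i. comps \<phi> i \<in> Mor C (obs S i) (obs T i)) \<and>
    (\<forall>i. comps \<phi> i \<cdot>\<^bsub>C\<^esub> bonds S i = bonds T i \<cdot>\<^bsub>C\<^esub> comps \<phi> (Suc i))"
  by (auto simp: Mor_def sequence_morphism_def)

lemma seq_mor_eqI:
  assumes "\<phi> \<in> Mor (inv_seq_cat C) S T" "\<psi> \<in> Mor (inv_seq_cat C) S T"
    and "\<And>i. comps \<phi> i = comps \<psi> i"
  shows "\<phi> = \<psi>"
  using assms by (cases \<phi>; cases \<psi>) (auto simp: Mor_inv_seq_cat_iff)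

context preadditive_category
begin

lemma seq_comp_mor:
  assumes "\<phi> \<in> Mor (inv_seq_cat C) S T" "\<psi> \<in> Mor (inv_seq_cat C) T U"
  shows "\<psi> \<cdot>\<^bsub>inv_seq_cat C\<^esub> \<phi> \<in> Mor (inv_seq_cat C) S U"
proof -
  have "comps \<psi> i \<cdot> comps \<phi> i \<cdot> bonds S i = bonds U i \<cdot> (comps \<psi> (Suc i) \<cdot> comps \<phi> (Suc i))" for i
  proof -
    have m: "comps \<phi> i \<in> Mor C (obs S i) (obs T i)" "comps \<psi> i \<in> Mor C (obs T i) (obs U i)"
      "bonds S i \<in> Mor C (obs S (Suc i)) (obs S i)" "bonds T i \<in> Mor C (obs T (Suc i)) (obs T i)"
      "bonds U i \<in> Mor C (obs U (Suc i)) (obs U i)"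
      "comps \<phi> (Suc i) \<in> Mor C (obs S (Suc i)) (obs T (Suc i))"
      "comps \<psi> (Suc i) \<in> Mor C (obs T (Suc i)) (obs U (Suc i))"
      using assms by (auto simp: Mor_inv_seq_cat_iff inverse_sequence_def)
    have "comps \<psi> i \<cdot> comps \<phi> i \<cdot> bonds S i = comps \<psi> i \<cdot> (bonds T i \<cdot> comps \<phi> (Suc i))"
      using assms comp_assoc[OF m(3,1,2)] by (simp add: Mor_inv_seq_cat_iff)
    also have "\<dots> = bonds U i \<cdot> (comps \<psi> (Suc i) \<cdot> comps \<phi> (Suc i))"
      using assms comp_assoc[OF m(6,4,2)] comp_assoc[OF m(6,7,5)] by (simp add: Mor_inv_seq_cat_iff)
    finally show ?thesis .
  qed
  then show ?thesis
    using assms comp_mor unfolding Mor_inv_seq_cat_iff inv_seq_cat_simps seq_mor.sel by blast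
qed

text \<open>The group laws hold in each component. Sums and differences remain compatible with the
  bonds because composition is bilinear.\<close>

lemma seq_mor_comm_group:
  assumes S: "inverse_sequence C S" and T: "inverse_sequence C T"
  shows "comm_group (mor_group (inv_seq_cat C) S T)"
proof -
  have ob: "obs S i \<in> Obj C" "obs T i \<in> Obj C"
    and bd: "bonds S i \<in> Mor C (obs S (Suc i)) (obs S i)"
      "bonds T i \<in> Mor C (obs T (Suc i)) (obs T i)" for i
    using S T by (auto simp: inverse_sequence_def)
  have grp: "comm_group (mor_group C (obs S i) (obs T i))" for i
    using mor_comm_group ob by blast
  have zero: "Zero (inv_seq_cat C) S T \<in> Mor (inv_seq_cat C) S T"
    using S T by (auto simp: Mor_inv_seq_cat_iff zero_mor ob zero_comp[OF bd(1)] comp_zero[OF bd(2)])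
  have add: "Add (inv_seq_cat C) \<phi> \<psi> \<in> Mor (inv_seq_cat C) S T"
    if "\<phi> \<in> Mor (inv_seq_cat C) S T" "\<psi> \<in> Mor (inv_seq_cat C) S T" for \<phi> \<psi>
  proof -
    have m: "comps \<phi> i \<in> Mor C (obs S i) (obs T i)" "comps \<psi> i \<in> Mor C (obs S i) (obs T i)" for i
      using that by (auto simp: Mor_inv_seq_cat_iff)
    show ?thesis
      using that by (auto simp: Mor_inv_seq_cat_iff add_mor
          add_comp[OF m bd(1)] comp_add[OF m bd(2)])
  qed
  have diff: "Seq_Mor S T (\<lambda>i. mor_diff C (comps \<phi> i) (comps \<psi> i)) \<in> Mor (inv_seq_cat C) S T"
    if "\<phi> \<in> Mor (inv_seq_cat C) S T" "\<psi> \<in> Mor (inv_seq_cat C) S T" for \<phi> \<psi>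
  proof -
    have m: "comps \<phi> i \<in> Mor C (obs S i) (obs T i)" "comps \<psi> i \<in> Mor C (obs S i) (obs T i)" for i
      using that by (auto simp: Mor_inv_seq_cat_iff)
    show ?thesis
      using that by (auto simp: Mor_inv_seq_cat_iff mor_diff_mor
          diff_comp[OF m bd(1)] comp_diff[OF m bd(2)])
  qed
  show ?thesis
  proof (rule comm_groupI; simp only: mor_group_simps)
    fix x y assume xy: "x \<in> Mor (inv_seq_cat C) S T" "y \<in> Mor (inv_seq_cat C) S T"
    show "Add (inv_seq_cat C) x y \<in> Mor (inv_seq_cat C) S T" by (rule add[OF xy])
    show "Add (inv_seq_cat C) x y = Add (inv_seq_cat C) y x"
    proof (rule seq_mor_eqI[OF add[OF xy] add[OF xy(2,1)]])
      fix i
      interpret M: comm_group "mor_group C (obs S i) (obs T i)" by (rule grp)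
      show "comps (Add (inv_seq_cat C) x y) i = comps (Add (inv_seq_cat C) y x) i"
        using M.m_comm[of "comps x i" "comps y i"] xy by (simp add: Mor_inv_seq_cat_iff)
    qed
    fix z assume z: "z \<in> Mor (inv_seq_cat C) S T"
    show "Add (inv_seq_cat C) (Add (inv_seq_cat C) x y) z =
      Add (inv_seq_cat C) x (Add (inv_seq_cat C) y z)"
    proof (rule seq_mor_eqI[OF add[OF add[OF xy] z] add[OF xy(1) add[OF xy(2) z]]])
      fix i
      interpret M: comm_group "mor_group C (obs S i) (obs T i)" by (rule grp)
      show "comps (Add (inv_seq_cat C) (Add (inv_seq_cat C) x y) z) i =
        comps (Add (inv_seq_cat C) x (Add (inv_seq_cat C) y z)) i"
        using M.m_assoc[of "comps x i" "comps y i" "comps z i"] xy z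
        by (simp add: Mor_inv_seq_cat_iff)
    qed
  next
    show "Zero (inv_seq_cat C) S T \<in> Mor (inv_seq_cat C) S T" by (rule zero)
  next
    fix x assume x: "x \<in> Mor (inv_seq_cat C) S T"
    then have m: "comps x i \<in> Mor C (obs S i) (obs T i)" for i
      by (simp add: Mor_inv_seq_cat_iff)
    show "Add (inv_seq_cat C) (Zero (inv_seq_cat C) S T) x = x"
      by (rule seq_mor_eqI[OF add[OF zero x] x]) (simp add: add_zero_left[OF m])
    \<comment> \<open>The negative of \<open>x\<close>, written as zero minus \<open>x\<close> in
      each component so that \<open>diff\<close> shows it to be a morphism of sequences.\<close>
    let ?n = "Seq_Mor S T (\<lambda>i. mor_diff C (comps (Zero (inv_seq_cat C) S T) i) (comps x i))"
    have "Add (inv_seq_cat C) ?n x = Zero (inv_seq_cat C) S T"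
      by (rule seq_mor_eqI[OF add[OF diff[OF zero x] x] zero])
        (simp add: mor_diff_add[OF zero_mor m] ob)
    then show "\<exists>y\<in>Mor (inv_seq_cat C) S T. Add (inv_seq_cat C) y x = Zero (inv_seq_cat C) S T"
      using diff[OF zero x] by blast
  qed
qed

text \<open>Makes the calculus of differences available for inverse sequences, where
  \<open>1 - I\<close> is formed.\<close>

lemma preadditive_inv_seq_cat: "preadditive_category (inv_seq_cat C)"
proof (intro preadditive_category.intro preadditive_category_axioms.intro category.intro)
  let ?D = "inv_seq_cat C"
  show "Dom ?D f \<in> Obj ?D" "Cod ?D f \<in> Obj ?D" if "f \<in> Arr ?D" for f
    using that by (auto simp: sequence_morphism_def)
  show idt: "Idt ?D S \<in> Mor ?D S S" if "S \<in> Obj ?D" for S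
  proof -
    have m: "obs S i \<in> Obj C" "bonds S i \<in> Mor C (obs S (Suc i)) (obs S i)" for i
      using that by (auto simp: inverse_sequence_def)
    show ?thesis
      using that by (auto simp: Mor_inv_seq_cat_iff idt_mor m idt_comp[OF m(2)] comp_idt[OF m(2)])
  qed
  fix f S T assume f: "f \<in> Mor ?D S T"
  have S: "S \<in> Obj ?D" and T: "T \<in> Obj ?D"
    and mf: "comps f i \<in> Mor C (obs S i) (obs T i)" for i
    using f by (auto simp: Mor_inv_seq_cat_iff)
  show "f \<cdot>\<^bsub>?D\<^esub> Idt ?D S = f"
    by (rule seq_mor_eqI[OF seq_comp_mor[OF idt[OF S] f] f]) (simp add: comp_idt[OF mf])
  show "Idt ?D T \<cdot>\<^bsub>?D\<^esub> f = f"
    by (rule seq_mor_eqI[OF seq_comp_mor[OF f idt[OF T]] f]) (simp add: idt_comp[OF mf])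
  fix g U assume g: "g \<in> Mor ?D T U"
  then have mg: "comps g i \<in> Mor C (obs T i) (obs U i)" for i
    by (simp add: Mor_inv_seq_cat_iff)
  show "g \<cdot>\<^bsub>?D\<^esub> f \<in> Mor ?D S U" by (rule seq_comp_mor[OF f g])
  fix h V assume "h \<in> Mor ?D U V"
  then have mh: "comps h i \<in> Mor C (obs U i) (obs V i)" for i
    by (simp add: Mor_inv_seq_cat_iff)
  show "h \<cdot>\<^bsub>?D\<^esub> (g \<cdot>\<^bsub>?D\<^esub> f) = h \<cdot>\<^bsub>?D\<^esub> g \<cdot>\<^bsub>?D\<^esub> f"
    by (simp add: comp_assoc[OF mf mg mh])
next
  let ?D = "inv_seq_cat C"
  show "comm_group (mor_group ?D S T)" if "S \<in> Obj ?D" "T \<in> Obj ?D" for S T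
    using that seq_mor_comm_group by simp
  show "h \<cdot>\<^bsub>?D\<^esub> Add ?D f g = Add ?D (h \<cdot>\<^bsub>?D\<^esub> f) (h \<cdot>\<^bsub>?D\<^esub> g)"
    if "f \<in> Mor ?D S T" "g \<in> Mor ?D S T" "h \<in> Mor ?D T U" for f g h S T U
    using that by (auto simp: Mor_inv_seq_cat_iff intro!: comp_add)
  show "Add ?D f g \<cdot>\<^bsub>?D\<^esub> h = Add ?D (f \<cdot>\<^bsub>?D\<^esub> h) (g \<cdot>\<^bsub>?D\<^esub> h)"
    if "f \<in> Mor ?D T U" "g \<in> Mor ?D T U" "h \<in> Mor ?D S T" for f g h S T U
    using that by (auto simp: Mor_inv_seq_cat_iff intro!: add_comp)
qed

text \<open>\<open>mor_diff\<close> uses an inverse in the group of sequence morphisms, which is not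
  visibly componentwise. Addition is componentwise, and it determines the difference.\<close>

lemma comps_mor_diff:
  assumes "\<phi> \<in> Mor (inv_seq_cat C) S T" "\<psi> \<in> Mor (inv_seq_cat C) S T"
  shows "comps (mor_diff (inv_seq_cat C) \<phi> \<psi>) i = mor_diff C (comps \<phi> i) (comps \<psi> i)"
proof -
  interpret D: preadditive_category "inv_seq_cat C" by (rule preadditive_inv_seq_cat)
  let ?\<delta> = "mor_diff (inv_seq_cat C) \<phi> \<psi>"
  have "Add C (comps ?\<delta> i) (comps \<psi> i) = comps \<phi> i"
    using arg_cong[OF D.mor_diff_add[OF assms], of "\<lambda>\<chi>. comps \<chi> i"] by simp
  moreover have "comps ?\<delta> i \<in> Mor C (obs S i) (obs T i)" "comps \<psi> i \<in> Mor C (obs S i) (obs T i)"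
    using D.mor_diff_mor[OF assms] assms(2) by (auto simp: Mor_inv_seq_cat_iff)
  ultimately show ?thesis using mor_diff_eqI by metis
qed

section \<open>Coproducts of inverse sequences\<close>

lemma coproduct_hom_eqI:
  assumes "is_coproduct C I X Q em" "h \<in> Mor C Q Y" "h' \<in> Mor C Q Y"
    and "\<And>i. i \<in> I \<Longrightarrow> h \<cdot> em i = h' \<cdot> em i"
  shows "h = h'"
proof -
  note D = is_coproductD[OF assms(1)]
  have "\<exists>!k. k \<in> Mor C Q Y \<and> (\<forall>i\<in>I. k \<cdot> em i = h' \<cdot> em i)"
    by (rule D(3)) (use assms(3) Mor_objs(2) comp_mor D(2) in blast)+
  then show ?thesis using assms by blast
qed

text \<open>Coproducts are computed level by level. The universal property at each level induces the
  bonds, and its uniqueness half gives all the commutation relations.\<close>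

lemma ex_coproduct_inv_seq_cat:
  assumes X: "\<And>n. n \<in> I \<Longrightarrow> inverse_sequence C (X n)"
    and Q: "\<And>i. is_coproduct C I (\<lambda>n. obs (X n) i) (Q i) (e i)"
  shows "\<exists>R em. is_coproduct (inv_seq_cat C) I X R em"
proof -
  note D = is_coproductD[OF Q]
  have Xb: "bonds (X n) i \<in> Mor C (obs (X n) (Suc i)) (obs (X n) i)" if "n \<in> I" for n i
    using X[OF that] by (simp add: inverse_sequence_def)
  \<comment> \<open>The bond from level \<open>Suc i\<close> to level \<open>i\<close> is induced by
    the bonds of the summands followed by the embeddings at level \<open>i\<close>.\<close>
  have "\<exists>b. b \<in> Mor C (Q (Suc i)) (Q i) \<and> (\<forall>n\<in>I. b \<cdot> e (Suc i) n = e i n \<cdot> bonds (X n) i)" for i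
    by (rule ex1_implies_ex, rule D(3)) (use D(1) comp_mor Xb D(2) in blast)+
  then obtain b where b: "b i \<in> Mor C (Q (Suc i)) (Q i)"
    and be: "n \<in> I \<Longrightarrow> b i \<cdot> e (Suc i) n = e i n \<cdot> bonds (X n) i" for i n
    by metis
  define R where "R = Inv_Seq Q b"
  define em where "em n = Seq_Mor (X n) R (\<lambda>i. e i n)" for n
  have R: "inverse_sequence C R" using D(1) b by (simp add: R_def inverse_sequence_def)
  have em: "em n \<in> Mor (inv_seq_cat C) (X n) R" if "n \<in> I" for n
    using R X that D(2)[OF that] be[OF that]
    by (auto simp: Mor_inv_seq_cat_iff em_def) (simp_all add: R_def)
  have "\<exists>!h. h \<in> Mor (inv_seq_cat C) R Y \<and> (\<forall>n\<in>I. h \<cdot>\<^bsub>inv_seq_cat C\<^esub> em n = g n)"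
    if Y: "inverse_sequence C Y" and g: "\<forall>n\<in>I. g n \<in> Mor (inv_seq_cat C) (X n) Y" for Y g
  proof -
    have Yo: "obs Y i \<in> Obj C" and Yb: "bonds Y i \<in> Mor C (obs Y (Suc i)) (obs Y i)" for i
      using Y by (auto simp: inverse_sequence_def)
    have gi: "comps (g n) i \<in> Mor C (obs (X n) i) (obs Y i)"
      and gc: "comps (g n) i \<cdot> bonds (X n) i = bonds Y i \<cdot> comps (g n) (Suc i)"
      and gst: "src (g n) = X n" "tgt (g n) = Y" if "n \<in> I" for n i
      using g that by (auto simp: Mor_inv_seq_cat_iff)
    have "\<exists>h. h \<in> Mor C (Q i) (obs Y i) \<and> (\<forall>n\<in>I. h \<cdot> e i n = comps (g n) i)" for i
      by (rule ex1_implies_ex, rule D(3)) (use Yo gi in blast)+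
    then obtain h where h: "h i \<in> Mor C (Q i) (obs Y i)"
      and he: "n \<in> I \<Longrightarrow> h i \<cdot> e i n = comps (g n) i" for i n
      by metis
    \<comment> \<open>The levelwise maps \<open>h i\<close> were chosen independently. That they
      commute with the bonds is checked on each embedding, where it reduces to
      \<open>gc\<close>.\<close>
    have "h i \<cdot> b i = bonds Y i \<cdot> h (Suc i)" for i
    proof (rule coproduct_hom_eqI[OF Q[of "Suc i"]])
      show "h i \<cdot> b i \<in> Mor C (Q (Suc i)) (obs Y i)"
        "bonds Y i \<cdot> h (Suc i) \<in> Mor C (Q (Suc i)) (obs Y i)"
        using comp_mor h b Yb by blast+
      fix n assume n: "n \<in> I"
      show "h i \<cdot> b i \<cdot> e (Suc i) n = bonds Y i \<cdot> h (Suc i) \<cdot> e (Suc i) n"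
        using comp_assoc[OF D(2)[OF n, of "Suc i"] b h]
          comp_assoc[OF D(2)[OF n, of "Suc i"] h Yb]
          comp_assoc[OF Xb[OF n] D(2)[OF n] h] he[OF n] be[OF n] gc[OF n] by simp
    qed
    then have hm: "Seq_Mor R Y h \<in> Mor (inv_seq_cat C) R Y"
      using R Y h by (auto simp: Mor_inv_seq_cat_iff) (simp_all add: R_def)
    show ?thesis
    proof (rule ex1I[of _ "Seq_Mor R Y h"], intro conjI ballI)
      show "Seq_Mor R Y h \<cdot>\<^bsub>inv_seq_cat C\<^esub> em n = g n" if "n \<in> I" for n
        by (rule seq_mor_eqI[OF seq_comp_mor[OF em[OF that] hm]])
          (use that g he in \<open>auto simp: em_def\<close>)
    next
      fix k assume k: "k \<in> Mor (inv_seq_cat C) R Y \<and> (\<forall>n\<in>I. k \<cdot>\<^bsub>inv_seq_cat C\<^esub> em n = g n)"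
      show "k = Seq_Mor R Y h"
      proof (rule seq_mor_eqI[OF _ hm])
        fix i
        have "comps k i = h i"
        proof (rule coproduct_hom_eqI[OF Q[of i]])
          show "comps k i \<in> Mor C (Q i) (obs Y i)"
            using k by (auto simp: Mor_inv_seq_cat_iff R_def)
          show "comps k i \<cdot> e i n = h i \<cdot> e i n" if "n \<in> I" for n
          proof -
            have "k \<cdot>\<^bsub>inv_seq_cat C\<^esub> em n = g n" using k that by blast
            then have "comps (k \<cdot>\<^bsub>inv_seq_cat C\<^esub> em n) i = comps (g n) i" by (rule arg_cong)
            then show ?thesis using he[OF that] by (simp add: em_def)
          qed
        qed (rule h)
        then show "comps k i = comps (Seq_Mor R Y h) i" by simp
      qed (use k in blast)
    qed (rule hm)
  qed
  then have "is_coproduct (inv_seq_cat C) I X R em"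
    using R em by (simp add: is_coproduct_def)
  then show ?thesis by blast
qed

end

section \<open>Maps out of truncated constant sequences\<close>

lemma trunc_seq_sel [simp]:
  "obs (trunc_seq C G n) = trunc_ob C G n"
  "bonds (trunc_seq C G n) i =
    (if i < n then Idt C G else Zero C (trunc_ob C G n (Suc i)) (trunc_ob C G n i))"
  by (simp_all add: trunc_seq_def)

context abelian_category
begin

lemma zero_obj: "is_zero_object C (zero_obj C)"
  unfolding zero_obj_def using ex_zero_object by (rule someI_ex)

lemma trunc_ob_obj: "G \<in> Obj C \<Longrightarrow> trunc_ob C G n i \<in> Obj C"
  using zero_obj by (simp add: trunc_ob_def is_zero_object_def)

lemma trunc_inverse_sequence: "G \<in> Obj C \<Longrightarrow> inverse_sequence C (trunc_seq C G n)"
  unfolding inverse_sequence_def trunc_seq_sel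
  by (auto simp: trunc_ob_obj zero_mor) (auto simp: trunc_ob_def idt_mor)

lemma trunc_hom_above:
  assumes "\<phi> \<in> Mor (inv_seq_cat C) (trunc_seq C G n) S" "n < i"
  shows "comps \<phi> i = Zero C (zero_obj C) (obs S i)"
proof (rule zero_object_mor_eq(1)[OF zero_obj])
  have "comps \<phi> i \<in> Mor C (trunc_ob C G n i) (obs S i)"
    using assms(1) by (simp add: Mor_inv_seq_cat_iff)
  then show "comps \<phi> i \<in> Mor C (zero_obj C) (obs S i)"
    using assms(2) by (simp add: trunc_ob_def)
qed

text \<open>Below the top level the bond of the source is the identity of \<open>G\<close>, so the
  commuting square reduces to this recursion.\<close>

lemma trunc_hom_below:
  assumes "\<phi> \<in> Mor (inv_seq_cat C) (trunc_seq C G n) S" "i < n"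
  shows "comps \<phi> i = bonds S i \<cdot> comps \<phi> (Suc i)"
proof -
  have "comps \<phi> i \<in> Mor C (trunc_ob C G n i) (obs S i)"
    and "comps \<phi> i \<cdot> bonds (trunc_seq C G n) i = bonds S i \<cdot> comps \<phi> (Suc i)"
    using assms(1) unfolding Mor_inv_seq_cat_iff trunc_seq_sel(1) by auto
  then show ?thesis using assms(2) comp_idt by (auto simp: trunc_ob_def)
qed

text \<open>The top component, at level \<open>n\<close>, determines the lower ones through the
  bonds of \<open>S\<close>, and the higher ones start at a zero object. Conversely, any
  \<open>x\<close> extends by pushing it down through the bonds.\<close>

lemma trunc_hom_bij:
  assumes G: "G \<in> Obj C" and S: "inverse_sequence C S"
  shows "bij_betw (\<lambda>\<phi>. comps \<phi> n) (Mor (inv_seq_cat C) (trunc_seq C G n) S) (Mor C G (obs S n))"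
  unfolding bij_betw_def
proof (intro conjI equalityI subsetI)
  show "inj_on (\<lambda>\<phi>. comps \<phi> n) (Mor (inv_seq_cat C) (trunc_seq C G n) S)"
  proof (rule inj_onI, rule seq_mor_eqI)
    fix \<phi> \<psi> i
    assume \<phi>: "\<phi> \<in> Mor (inv_seq_cat C) (trunc_seq C G n) S"
      and \<psi>: "\<psi> \<in> Mor (inv_seq_cat C) (trunc_seq C G n) S" and eq: "comps \<phi> n = comps \<psi> n"
    show "comps \<phi> i = comps \<psi> i"
    proof (cases "i \<le> n")
      case True
      then show ?thesis
      proof (induction i rule: inc_induct)
        case (step i)
        then show ?case using trunc_hom_below[OF \<phi>] trunc_hom_below[OF \<psi>] by simp
      qed (rule eq)
    next
      case False
      then show ?thesis using trunc_hom_above[OF \<phi>] trunc_hom_above[OF \<psi>] by simp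
    qed
  qed
next
  fix x assume "x \<in> (\<lambda>\<phi>. comps \<phi> n) ` Mor (inv_seq_cat C) (trunc_seq C G n) S"
  then obtain \<phi> where "\<phi> \<in> Mor (inv_seq_cat C) (trunc_seq C G n) S" "x = comps \<phi> n" by blast
  then have "x \<in> Mor C (trunc_ob C G n n) (obs S n)" by (simp add: Mor_inv_seq_cat_iff)
  then show "x \<in> Mor C G (obs S n)" by (simp add: trunc_ob_def)
next
  fix x assume x: "x \<in> Mor C G (obs S n)"
  have So: "obs S i \<in> Obj C" and Sb: "bonds S i \<in> Mor C (obs S (Suc i)) (obs S i)" for i
    using S by (auto simp: inverse_sequence_def)
  \<comment> \<open>\<open>e k\<close> is \<open>x\<close> followed by \<open>k\<close> bonds of
    \<open>S\<close>, hence the intended component at level \<open>n - k\<close>; the recursion runs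
    downwards from the top.\<close>
  define e where "e = rec_nat x (\<lambda>k y. bonds S (n - Suc k) \<cdot> y)"
  have e0: "e 0 = x" and eS: "e (Suc k) = bonds S (n - Suc k) \<cdot> e k" for k
    by (simp_all add: e_def)
  have em: "e k \<in> Mor C G (obs S (n - k))" if "k \<le> n" for k
    using that
  proof (induction k)
    case 0
    then show ?case using x by (simp add: e0)
  next
    case (Suc k)
    then have "e k \<in> Mor C G (obs S (Suc (n - Suc k)))" by (simp add: Suc_diff_Suc)
    then show ?case unfolding eS by (rule comp_mor) (rule Sb)
  qed
  define c where "c i = (if i \<le> n then e (n - i) else Zero C (zero_obj C) (obs S i))" for i
  have z: "zero_obj C \<in> Obj C" using zero_obj by (simp add: is_zero_object_def)
  have cm: "c i \<in> Mor C (trunc_ob C G n i) (obs S i)" for i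
    using em[of "n - i"] zero_mor[OF z So] by (auto simp: c_def trunc_ob_def)
  have "c i \<cdot> bonds (trunc_seq C G n) i = bonds S i \<cdot> c (Suc i)" for i
  proof (cases "i < n")
    case True
    have "c i \<in> Mor C G (obs S i)" using cm[of i] True by (simp add: trunc_ob_def)
    then have "c i \<cdot> bonds (trunc_seq C G n) i = c i" using True comp_idt by simp
    also have "\<dots> = bonds S i \<cdot> c (Suc i)"
      using True eS[of "n - Suc i"] by (simp add: c_def Suc_diff_Suc)
    finally show ?thesis .
  next
    \<comment> \<open>Both sides are zero. This includes \<open>i = n\<close>: there
      \<open>c n\<close> is \<open>x\<close>, but the bond of the truncated sequence into level
      \<open>n\<close> already starts at the zero object.\<close>
    case False
    then show ?thesis
      using comp_zero[OF cm[of i] trunc_ob_obj[OF G, of n "Suc i"]] comp_zero[OF Sb[of i] z]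
      by (simp add: c_def trunc_ob_def)
  qed
  then have "Seq_Mor (trunc_seq C G n) S c \<in> Mor (inv_seq_cat C) (trunc_seq C G n) S"
    unfolding Mor_inv_seq_cat_iff using trunc_inverse_sequence[OF G] S cm by simp
  then show "x \<in> (\<lambda>\<phi>. comps \<phi> n) ` Mor (inv_seq_cat C) (trunc_seq C G n) S"
    by (rule rev_image_eqI) (simp add: c_def e0)
qed

lemma trunc_incl_mor:
  assumes G: "G \<in> Obj C"
  shows "trunc_incl C G n \<in> Mor (inv_seq_cat C) (trunc_seq C G n) (trunc_seq C G (Suc n))"
proof -
  let ?T = "trunc_ob C G"
  define c where "c i = (if i \<le> n then Idt C G else Zero C (?T n i) (?T (Suc n) i))" for i
  have cm: "c i \<in> Mor C (?T n i) (?T (Suc n) i)" for i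
    by (cases "i \<le> n") (simp_all add: c_def zero_mor trunc_ob_obj G, simp add: trunc_ob_def idt_mor G)
  have bm: "bonds (trunc_seq C G (Suc n)) i \<in> Mor C (?T (Suc n) (Suc i)) (?T (Suc n) i)" for i
    using trunc_inverse_sequence[OF G] by (simp add: inverse_sequence_def del: trunc_seq_sel(2))
  have "c i \<cdot> bonds (trunc_seq C G n) i = bonds (trunc_seq C G (Suc n)) i \<cdot> c (Suc i)" for i
  proof (cases "i < n")
    case True
    then show ?thesis by (simp add: c_def)
  next
    \<comment> \<open>Both composites start at the zero object. At \<open>i = n\<close> the bond of
      the longer sequence is still an identity, and the vanishing of \<open>c (Suc n)\<close> makes
      the square commute.\<close>
    case False
    then have "bonds (trunc_seq C G n) i = Zero C (?T n (Suc i)) (?T n i)"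
      "c (Suc i) = Zero C (?T n (Suc i)) (?T (Suc n) (Suc i))"
      by (auto simp: c_def)
    then show ?thesis
      using comp_zero[OF cm] comp_zero[OF bm] trunc_ob_obj[OF G] by presburger
  qed
  then show ?thesis
    unfolding Mor_inv_seq_cat_iff trunc_incl_def
    using trunc_inverse_sequence[OF G] cm by (simp add: c_def del: trunc_seq_sel(2))
qed

end

section \<open>Both conditions in terms of families of morphisms\<close>

text \<open>The common form of \<open>1 - F\<close> and \<open>1 - I\<close>, in which neither the
  product nor the direct sum appears.\<close>

definition family_diff :: "('o, 'm, 'z) preadd_category_scheme \<Rightarrow> ('o, 'm) inv_seq \<Rightarrow>
    (nat \<Rightarrow> 'm) \<Rightarrow> nat \<Rightarrow> 'm" where
  "family_diff C S x = (\<lambda>n. mor_diff C (x n) (bonds S n \<cdot>\<^bsub>C\<^esub> x (Suc n)))"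

text \<open>On \<open>X\<close> the maps \<open>\<alpha> \<circ> u\<close> and
  \<open>v \<circ> \<alpha>\<close> agree, and composing with the bijection \<open>\<alpha>\<close>
  on either side does not affect bijectivity.\<close>

lemma bij_betw_conjugate:
  assumes \<alpha>: "bij_betw \<alpha> X T" and u: "u ` X \<subseteq> X"
    and \<alpha>u: "\<And>x. x \<in> X \<Longrightarrow> \<alpha> (u x) = v (\<alpha> x)"
  shows "bij_betw u X X \<longleftrightarrow> bij_betw v T T"
proof -
  have "bij_betw u X X \<longleftrightarrow> bij_betw (\<alpha> \<circ> u) X T"
    using bij_betw_comp_iff2[OF \<alpha> u] .
  also have "\<dots> \<longleftrightarrow> bij_betw (v \<circ> \<alpha>) X T"
    by (rule bij_betw_cong) (simp add: \<alpha>u)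
  also have "\<dots> \<longleftrightarrow> bij_betw v T T"
    using bij_betw_comp_iff[OF \<alpha>] by blast
  finally show ?thesis .
qed

text \<open>Recasts a universal property as a bijection with families, for use with both the product
  and the direct sum.\<close>

lemma bij_betw_families:
  assumes r: "\<And>h n. h \<in> H \<Longrightarrow> r h n \<in> B n"
    and ex1: "\<And>x. (\<And>n. x n \<in> B n) \<Longrightarrow> \<exists>!h. h \<in> H \<and> (\<forall>n. r h n = x n)"
  shows "bij_betw r H {x. \<forall>n. x n \<in> B n}"
  unfolding bij_betw_def
proof (intro conjI equalityI subsetI)
  show "inj_on r H"
  proof (rule inj_onI)
    fix g h assume gh: "g \<in> H" "h \<in> H" "r g = r h"
    have "\<exists>!k. k \<in> H \<and> (\<forall>n. r k n = r h n)" by (rule ex1) (rule r[OF gh(2)])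
    then show "g = h" using gh by auto
  qed
  show "x \<in> {x. \<forall>n. x n \<in> B n}" if "x \<in> r ` H" for x
    using that r by blast
  show "x \<in> r ` H" if "x \<in> {x. \<forall>n. x n \<in> B n}" for x
  proof -
    have "\<exists>!h. h \<in> H \<and> (\<forall>n. r h n = x n)" by (rule ex1) (use that in blast)
    then obtain h where "h \<in> H" "\<forall>n. r h n = x n" by blast
    then show ?thesis by (intro image_eqI[of _ _ h]) auto
  qed
qed

context abelian_category
begin

text \<open>Vanishing of kernel and cokernel of \<open>1 - F\<close> is tested on morphisms from
  \<open>G\<close> to the product, and the projections carry these to families.\<close>

lemma local_sequence_iff_family_diff:
  assumes G: "generator C G" and S: "inverse_sequence C S"
    and ex: "\<exists>P pr. is_product C UNIV (obs S) P pr"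
  shows "local_sequence C S \<longleftrightarrow>
    bij_betw (family_diff C S) {x. \<forall>n. x n \<in> Mor C G (obs S n)} {x. \<forall>n. x n \<in> Mor C G (obs S n)}"
proof -
  obtain P pr where sp: "seq_product C S = (P, pr)" by fastforce
  have "case seq_product C S of (P, pr) \<Rightarrow> is_product C UNIV (obs S) P pr"
    unfolding seq_product_def by (rule someI_ex) (use ex in auto)
  then have P: "is_product C UNIV (obs S) P pr" by (simp add: sp)
  note D = is_productD[OF P]
  have pr: "pr n \<in> Mor C P (obs S n)" for n using D(2) by simp
  have Sb: "bonds S i \<in> Mor C (obs S (Suc i)) (obs S i)" for i
    using S by (auto simp: inverse_sequence_def)
  define F where "F = seq_shift C S"
  have "\<exists>!F. F \<in> Mor C P P \<and> (\<forall>j. pr j \<cdot> F = bonds S j \<cdot> pr (Suc j))"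
    using D(3)[OF D(1), of "\<lambda>j. bonds S j \<cdot> pr (Suc j)"] comp_mor[OF pr Sb] by simp
  \<comment> \<open>The universal property makes the definite description in
    \<open>seq_shift\<close> meaningful.\<close>
  then have "F \<in> Mor C P P \<and> (\<forall>j. pr j \<cdot> F = bonds S j \<cdot> pr (Suc j))"
    unfolding F_def seq_shift_def sp Let_def prod.case by (rule theI')
  then have F: "F \<in> Mor C P P" and prF: "pr j \<cdot> F = bonds S j \<cdot> pr (Suc j)" for j by auto
  define d where "d = one_minus_shift C S"
  have d_eq: "d = mor_diff C (Idt C P) F" by (simp add: d_def one_minus_shift_def F_def sp)
  note idP = idt_mor[OF D(1)]
  have d: "d \<in> Mor C P P" unfolding d_eq by (rule mor_diff_mor[OF idP F])
  then have dA: "d \<in> Arr C" by (simp add: Mor_def)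
  have GO: "G \<in> Obj C" using G by (simp add: generator_def)
  have bij: "bij_betw (\<lambda>h n. pr n \<cdot> h) (Mor C G P) {x. \<forall>n. x n \<in> Mor C G (obs S n)}"
    by (rule bij_betw_families) (use comp_mor pr D(3)[OF GO] in auto)
  have conj: "(\<lambda>n. pr n \<cdot> (d \<cdot> h)) = family_diff C S (\<lambda>n. pr n \<cdot> h)" if h: "h \<in> Mor C G P" for h
  proof
    fix n
    have "d \<cdot> h = mor_diff C h (F \<cdot> h)"
      unfolding d_eq using diff_comp[OF idP F h] idt_comp[OF h] by simp
    then have "pr n \<cdot> (d \<cdot> h) = mor_diff C (pr n \<cdot> h) (pr n \<cdot> (F \<cdot> h))"
      using comp_diff[OF h comp_mor[OF h F] pr] by simp
    also have "pr n \<cdot> (F \<cdot> h) = bonds S n \<cdot> (pr (Suc n) \<cdot> h)"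
      using comp_assoc[OF h F pr] comp_assoc[OF h pr Sb] prF by simp
    finally show "pr n \<cdot> (d \<cdot> h) = family_diff C S (\<lambda>n. pr n \<cdot> h) n"
      by (simp add: family_diff_def)
  qed
  \<comment> \<open>The limit objects come from a chosen kernel and cokernel; the criterion applies
    to any choice.\<close>
  have "local_sequence C S \<longleftrightarrow> bij_betw (\<lambda>h. d \<cdot> h) (Mor C G P) (Mor C G P)"
    unfolding local_sequence_def lim_obj_def lim1_obj_def d_def[symmetric]
    by (rule zero_kernel_cokernel_iff[OF G d])
      (use someI_ex[OF ex_kernel[OF dA]] someI_ex[OF ex_cokernel[OF dA]] in auto)
  also have "\<dots> \<longleftrightarrow> bij_betw (family_diff C S)
      {x. \<forall>n. x n \<in> Mor C G (obs S n)} {x. \<forall>n. x n \<in> Mor C G (obs S n)}"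
    by (rule bij_betw_conjugate[OF bij]) (use comp_mor[OF _ d] conj in auto)
  finally show ?thesis .
qed

text \<open>A morphism from the direct sum to \<open>S\<close> is a family of morphisms from the
  truncated sequences, and each of these is given by its top component.\<close>

lemma local_object_iff_family_diff:
  assumes GO: "G \<in> Obj C" and S: "inverse_sequence C S"
    and ex: "\<exists>Q em. is_coproduct (inv_seq_cat C) UNIV (trunc_seq C G) Q em"
  shows "local_object (inv_seq_cat C) (one_minus_G_tilde_shift C G) S \<longleftrightarrow>
    bij_betw (family_diff C S) {x. \<forall>n. x n \<in> Mor C G (obs S n)} {x. \<forall>n. x n \<in> Mor C G (obs S n)}"
proof -
  let ?D = "inv_seq_cat C"
  interpret D: preadditive_category ?D by (rule preadditive_inv_seq_cat)
  obtain Q em where gt: "G_tilde C G = (Q, em)" by fastforce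
  have "case G_tilde C G of (Q, em) \<Rightarrow> is_coproduct ?D UNIV (trunc_seq C G) Q em"
    unfolding G_tilde_def by (rule someI_ex) (use ex in auto)
  then have Q: "is_coproduct ?D UNIV (trunc_seq C G) Q em" by (simp add: gt)
  note U = is_coproductD[OF Q]
  have em: "em n \<in> Mor ?D (trunc_seq C G n) Q" for n using U(2) by simp
  note \<iota> = trunc_incl_mor[OF GO]
  define I where "I = G_tilde_shift C G"
  have "\<exists>!I. I \<in> Mor ?D Q Q \<and> (\<forall>n. I \<cdot>\<^bsub>?D\<^esub> em n = em (Suc n) \<cdot>\<^bsub>?D\<^esub> trunc_incl C G n)"
    using U(3)[OF U(1), of "\<lambda>n. em (Suc n) \<cdot>\<^bsub>?D\<^esub> trunc_incl C G n"] D.comp_mor[OF \<iota> em]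
    by (simp del: inv_seq_cat_simps)
  then have "I \<in> Mor ?D Q Q \<and> (\<forall>n. I \<cdot>\<^bsub>?D\<^esub> em n = em (Suc n) \<cdot>\<^bsub>?D\<^esub> trunc_incl C G n)"
    unfolding I_def G_tilde_shift_def gt Let_def prod.case by (rule theI')
  then have I: "I \<in> Mor ?D Q Q"
    and Iem: "I \<cdot>\<^bsub>?D\<^esub> em n = em (Suc n) \<cdot>\<^bsub>?D\<^esub> trunc_incl C G n" for n by auto
  define t where "t = one_minus_G_tilde_shift C G"
  have t_eq: "t = mor_diff ?D (Idt ?D Q) I"
    by (simp add: t_def one_minus_G_tilde_shift_def I_def gt)
  note idQ = D.idt_mor[OF U(1)]
  have t: "t \<in> Mor ?D Q Q" unfolding t_eq by (rule D.mor_diff_mor[OF idQ I])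
  have SO: "S \<in> Obj ?D" using S by simp
  note tb = trunc_hom_bij[OF GO S]
  \<comment> \<open>Restrict to the summand with index \<open>n\<close>, then take the component at
    its top level \<open>n\<close>.\<close>
  let ?\<alpha> = "\<lambda>\<phi> n. comps (\<phi> \<cdot>\<^bsub>?D\<^esub> em n) n"
  have bij: "bij_betw ?\<alpha> (Mor ?D Q S) {x. \<forall>n. x n \<in> Mor C G (obs S n)}"
  proof (rule bij_betw_families)
    show "?\<alpha> \<phi> n \<in> Mor C G (obs S n)" if "\<phi> \<in> Mor ?D Q S" for \<phi> n
      by (rule bij_betwE[OF tb, rule_format]) (rule D.comp_mor[OF em that])
    fix x assume x: "\<And>n. x n \<in> Mor C G (obs S n)"
    \<comment> \<open>\<open>\<psi> n\<close> is the unique extension of \<open>x n\<close> to the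
      whole truncated sequence. Prescribing top components thus amounts to prescribing the
      restrictions of \<open>\<phi>\<close> to the summands.\<close>
    define \<psi> where "\<psi> n = inv_into (Mor ?D (trunc_seq C G n) S) (\<lambda>\<phi>. comps \<phi> n) (x n)" for n
    have \<psi>: "\<psi> n \<in> Mor ?D (trunc_seq C G n) S" "comps (\<psi> n) n = x n" for n
      unfolding \<psi>_def
      by (rule bij_betwE[OF bij_betw_inv_into[OF tb], rule_format, OF x],
        rule bij_betw_inv_into_right[OF tb x])
    have "\<exists>!\<phi>. \<phi> \<in> Mor ?D Q S \<and> (\<forall>n\<in>UNIV. \<phi> \<cdot>\<^bsub>?D\<^esub> em n = \<psi> n)"
      by (rule U(3)[OF SO]) (rule \<psi>(1))
    moreover have "\<phi> \<cdot>\<^bsub>?D\<^esub> em n = \<psi> n \<longleftrightarrow> ?\<alpha> \<phi> n = x n" if "\<phi> \<in> Mor ?D Q S" for \<phi> n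
      unfolding \<psi>(2)[of n, symmetric]
      by (rule inj_on_eq_iff[OF bij_betw_imp_inj_on[OF tb] D.comp_mor[OF em that] \<psi>(1), symmetric])
    ultimately show "\<exists>!\<phi>. \<phi> \<in> Mor ?D Q S \<and> (\<forall>n. ?\<alpha> \<phi> n = x n)"
      by (simp cong: conj_cong del: inv_seq_cat_simps)
  qed
  have conj: "?\<alpha> (\<phi> \<cdot>\<^bsub>?D\<^esub> t) = family_diff C S (?\<alpha> \<phi>)" if \<phi>: "\<phi> \<in> Mor ?D Q S" for \<phi>
  proof
    fix n
    define \<chi> where "\<chi> = \<phi> \<cdot>\<^bsub>?D\<^esub> em (Suc n)"
    have \<chi>: "\<chi> \<in> Mor ?D (trunc_seq C G (Suc n)) S"
      unfolding \<chi>_def by (rule D.comp_mor[OF em \<phi>])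
    have "\<phi> \<cdot>\<^bsub>?D\<^esub> t = mor_diff ?D \<phi> (\<phi> \<cdot>\<^bsub>?D\<^esub> I)"
      unfolding t_eq D.comp_diff[OF idQ I \<phi>] D.comp_idt[OF \<phi>] ..
    then have "\<phi> \<cdot>\<^bsub>?D\<^esub> t \<cdot>\<^bsub>?D\<^esub> em n = mor_diff ?D (\<phi> \<cdot>\<^bsub>?D\<^esub> em n) (\<phi> \<cdot>\<^bsub>?D\<^esub> I \<cdot>\<^bsub>?D\<^esub> em n)"
      by (simp only: D.diff_comp[OF \<phi> D.comp_mor[OF I \<phi>] em])
    also have "\<phi> \<cdot>\<^bsub>?D\<^esub> I \<cdot>\<^bsub>?D\<^esub> em n = \<chi> \<cdot>\<^bsub>?D\<^esub> trunc_incl C G n"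
      unfolding \<chi>_def D.comp_assoc[OF em I \<phi>, symmetric]
        D.comp_assoc[OF \<iota> em \<phi>, symmetric] Iem ..
    finally have "?\<alpha> (\<phi> \<cdot>\<^bsub>?D\<^esub> t) n =
        mor_diff C (?\<alpha> \<phi> n) (comps (\<chi> \<cdot>\<^bsub>?D\<^esub> trunc_incl C G n) n)"
      by (simp only: comps_mor_diff[OF D.comp_mor[OF em \<phi>] D.comp_mor[OF \<iota> \<chi>]])
    \<comment> \<open>At level \<open>n\<close> the inclusion is the identity of
      \<open>G\<close>.\<close>
    also have "comps (\<chi> \<cdot>\<^bsub>?D\<^esub> trunc_incl C G n) n = comps \<chi> n"
    proof -
      have "comps \<chi> n \<in> Mor C (trunc_ob C G (Suc n) n) (obs S n)"
        using \<chi> by (simp add: Mor_inv_seq_cat_iff)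
      then show ?thesis using comp_idt by (simp add: trunc_incl_def trunc_ob_def)
    qed
    \<comment> \<open>The source of \<open>\<chi>\<close> reaches up to level \<open>Suc n\<close>,
      so level \<open>n\<close> lies just below its top. The shift of index by one is what brings in
      the bond of \<open>S\<close>.\<close>
    also have "\<dots> = bonds S n \<cdot> comps \<chi> (Suc n)"
      by (rule trunc_hom_below[OF \<chi>]) simp
    finally show "?\<alpha> (\<phi> \<cdot>\<^bsub>?D\<^esub> t) n = family_diff C S (?\<alpha> \<phi>) n"
      unfolding family_diff_def \<chi>_def .
  qed
  have "local_object ?D t S \<longleftrightarrow> bij_betw (\<lambda>\<phi>. \<phi> \<cdot>\<^bsub>?D\<^esub> t) (Mor ?D Q S) (Mor ?D Q S)"
    using t unfolding local_object_def Mor_def by simp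
  also have "\<dots> \<longleftrightarrow> bij_betw (family_diff C S)
      {x. \<forall>n. x n \<in> Mor C G (obs S n)} {x. \<forall>n. x n \<in> Mor C G (obs S n)}"
    by (rule bij_betw_conjugate[OF bij]) (use D.comp_mor[OF t] conj in blast)+
  finally show ?thesis unfolding t_def .
qed

end

section \<open>Comparison of the two notions of locality\<close>

theorem proposition2p3:
  fixes A :: "('o, 'm) preadd_category"
    and small :: "'i set \<Rightarrow> bool"
    and G :: 'o
    and S :: "('o, 'm) inv_seq"
  assumes "smallness small"
    and "abelian_category A"
    and "generator A G"
    and "has_small_sums small A"
    and "has_small_products small A"
    and "small_products_exact small A"
    and "inverse_sequence A S"
  shows "local_sequence A S \<longleftrightarrow>
    local_object (inv_seq_cat A) (one_minus_G_tilde_shift A G) S"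
proof -
  interpret abelian_category A by (rule assms(2))
  have G: "G \<in> Obj A" using assms(3) by (simp add: generator_def)
  have "\<exists>P pr. is_product A UNIV (obs S) P pr"
    by (rule ex_countable_product[OF assms(1,5)])
      (use assms(7) in \<open>simp add: inverse_sequence_def\<close>)
  then have "local_sequence A S \<longleftrightarrow> bij_betw (family_diff A S)
      {x. \<forall>n. x n \<in> Mor A G (obs S n)} {x. \<forall>n. x n \<in> Mor A G (obs S n)}"
    by (rule local_sequence_iff_family_diff[OF assms(3,7)])
  \<comment> \<open>The direct sum lives in the category of inverse sequences, so its existence is
    derived from countable sums in \<open>A\<close> at each level.\<close>
  moreover have "\<exists>Q em. is_coproduct (inv_seq_cat A) UNIV (trunc_seq A G) Q em"
  proof -
    have "\<forall>i. \<exists>Q em. is_coproduct A UNIV (\<lambda>n. obs (trunc_seq A G n) i) Q em"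
      using ex_countable_coproduct[OF assms(1,4)] trunc_ob_obj[OF G] by simp
    then obtain Q e where "\<And>i. is_coproduct A UNIV (\<lambda>n. obs (trunc_seq A G n) i) (Q i) (e i)"
      by metis
    then show ?thesis by (rule ex_coproduct_inv_seq_cat[OF trunc_inverse_sequence[OF G]])
  qed
  then have "local_object (inv_seq_cat A) (one_minus_G_tilde_shift A G) S \<longleftrightarrow>
      bij_betw (family_diff A S)
        {x. \<forall>n. x n \<in> Mor A G (obs S n)} {x. \<forall>n. x n \<in> Mor A G (obs S n)}"
    by (rule local_object_iff_family_diff[OF G assms(7)])
  ultimately show ?thesis by simp
qed

end
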